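(* Let $G$ be a group of homeomorphisms of a Cantor space $X$ such that each $G$-orbit is dense. Then the set $K_G$ of all $G$-invariant Borel probability measures on $X$ is approximately divisible.
   Context: A set $K$ of Borel probability measures on a Cantor space $X$ is approximately divisible if for any clopen $A\subseteq X$, any positive integer $n$ and any $\varepsilon>0$ there exists a clopen $B\subseteq A$ such that $\mu(A)-\varepsilon\le n\mu(B)\le\mu(A)$ for all $\mu\in K$. *)

theory Defs
  imports "HOL-Probability.Probability"
begin

definition cantor_space :: "'a topology \<Rightarrow> bool" where
  "cantor_space X \<longleftrightarrow>
     X homeomorphic_space
       product_topology (\<lambda>_::nat. discrete_topology (UNIV :: bool set)) UNIV"

definition homeomorphism_group :: "('a::topological_space \<Rightarrow> 'a) set \<Rightarrow> bool" where
  "homeomorphism_group G \<longleftrightarrow>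
     (\<forall>g\<in>G. homeomorphism UNIV UNIV g (inv g)) \<and>
     id \<in> G \<and>
     (\<forall>g\<in>G. \<forall>h\<in>G. g \<circ> h \<in> G) \<and>
     (\<forall>g\<in>G. inv g \<in> G)"

definition orbit_of :: "('a \<Rightarrow> 'a) set \<Rightarrow> 'a \<Rightarrow> 'a set" where
  "orbit_of G x = {g x | g. g \<in> G}"

definition borel_prob_measures :: "'a::topological_space measure set" where
  "borel_prob_measures = {M. prob_space M \<and> sets M = sets borel}"

definition invariant_measures :: "('a::topological_space \<Rightarrow> 'a) set \<Rightarrow> 'a measure set" where
  "invariant_measures G = {M \<in> borel_prob_measures. \<forall>g\<in>G. distr M borel g = M}"

definition approximately_divisible :: "'a::topological_space measure set \<Rightarrow> bool" where
  "approximately_divisible K \<longleftrightarrow>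
     K \<subseteq> borel_prob_measures \<and>
     (\<forall>A. open A \<and> closed A \<longrightarrow>
       (\<forall>n::nat. n > 0 \<longrightarrow>
         (\<forall>\<epsilon>::real. \<epsilon> > 0 \<longrightarrow>
           (\<exists>B. open B \<and> closed B \<and> B \<subseteq> A \<and>
             (\<forall>M\<in>K. measure M A - \<epsilon> \<le> real n * measure M B \<and>
                     real n * measure M B \<le> measure M A)))))"

end

theory Submission imports Defs begin

text \<open>
  Since orbits are infinite, \<open>A\<close> is a finite disjoint union of clopen sets \<open>U i\<close>, each of which has
  \<open>N\<close> pairwise disjoint translates.  Join \<open>y \<in> U i\<close> to its \<open>N\<close> translates \<open>x\<close>; the neighbours
  \<open>y\<close> of a given \<open>x\<close> lie in distinct, hence disjoint, \<open>U i\<close>.  Greedily remove from \<open>A\<close> groups of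
  \<open>n\<close> neighbours of a common point: the removed set is exactly \<open>n\<close>-divisible, and each point
  has fewer than \<open>n\<close> neighbours in the remaining set \<open>F\<close>.  Counting edges out of \<open>F\<close> gives
  \<open>N \<mu>(F) \<le> n\<close> for every invariant probability measure \<open>\<mu>\<close>.
\<close>

section \<open>Topology of Cantor spaces: compactness, infinitude, clopen separation\<close>

lemma cantor_space_compact:
  assumes "cantor_space (euclidean :: 'a::topological_space topology)"
  shows "compact (UNIV :: 'a set)"
proof -
  have "compact_space (euclidean :: 'a topology)"
    using assms unfolding cantor_space_def
    by (metis homeomorphic_compact_space compact_space_product_topology
        compact_space_discrete_topology finite)
  then show ?thesis by (simp add: compact_space_def)
qed

lemma cantor_space_infinite:
  assumes "cantor_space (euclidean :: 'a::topological_space topology)"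
  shows "infinite (UNIV :: 'a set)"
proof -
  obtain f :: "'a \<Rightarrow> nat \<Rightarrow> bool" where "homeomorphic_map euclidean
      (product_topology (\<lambda>_. discrete_topology UNIV) UNIV) f"
    using assms unfolding cantor_space_def homeomorphic_space by blast
  then have "range f = UNIV"
    by (auto dest: homeomorphic_imp_surjective_map)
  moreover have "infinite (UNIV :: (nat \<Rightarrow> bool) set)"
    by (simp add: finite_UNIV_fun)
  ultimately show ?thesis by (metis finite_imageI)
qed

text \<open>Distinct points have images in the product that differ in some coordinate, and each
  coordinate is a continuous map into a discrete space, so its fibres are clopen.\<close>

lemma cantor_space_clopen_separation:
  assumes "cantor_space (euclidean :: 'a::topological_space topology)" and "x \<noteq> (y :: 'a)"
  obtains C where "open C" "closed C" "x \<in> C" "y \<notin> C"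
proof -
  let ?T = "product_topology (\<lambda>_::nat. discrete_topology (UNIV :: bool set)) UNIV"
  obtain f where f: "homeomorphic_map (euclidean :: 'a topology) ?T f"
    using assms unfolding cantor_space_def homeomorphic_space by blast
  have "f x \<noteq> f y"
    using homeomorphic_imp_injective_map[OF f] assms(2) by (auto dest: injD)
  then obtain n where n: "f x n \<noteq> f y n" by blast
  have cont: "continuous_map euclidean (discrete_topology UNIV) (\<lambda>z. f z n)"
    using continuous_map_compose[OF homeomorphic_imp_continuous_map[OF f]
        continuous_map_product_projection[of n UNIV "\<lambda>_. discrete_topology UNIV"]]
    by (simp add: comp_def)
  have op: "open {z. f z n \<in> S}" for S
    using openin_continuous_map_preimage[OF cont, of S] by simp
  have "- {z. f z n \<in> {f x n}} = {z. f z n \<in> - {f x n}}" by auto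
  then have "closed {z. f z n \<in> {f x n}}" unfolding closed_def using op by metis
  then show thesis using that[OF op] n by blast
qed

text \<open>Clopen separation makes singletons closed, so a finite dense set would be closed and
  hence the whole infinite space. Applied to orbits, this turns density into an unlimited supply of
  distinct translates of a point.\<close>

lemma cantor_space_infinite_if_dense:
  assumes X: "cantor_space (euclidean :: 'a::topological_space topology)"
    and dense: "closure S = (UNIV :: 'a set)"
  shows "infinite S"
proof
  assume "finite S"
  have "open (- {y})" for y :: 'a
  proof (subst open_subopen, intro ballI)
    fix x assume "x \<in> - {y}"
    then have "x \<noteq> y" by simp
    then obtain C where "open C" "x \<in> C" "y \<notin> C"
      by (rule cantor_space_clopen_separation[OF X])
    then show "\<exists>T. open T \<and> x \<in> T \<and> T \<subseteq> - {y}" by blast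
  qed
  then have "closed (\<Union>y\<in>S. {y})"
    by (intro closed_UN \<open>finite S\<close>) (simp add: closed_def)
  with dense have "S = UNIV" by (simp add: closure_closed)
  with \<open>finite S\<close> cantor_space_infinite[OF X] show False by simp
qed

section \<open>Translates of clopen sets and invariance of measures\<close>

lemma homeomorphism_group_props:
  assumes "homeomorphism_group G" "g \<in> G"
  shows "bij g" "continuous_on UNIV g" "inv g \<in> G"
proof -
  have h: "homeomorphism UNIV UNIV g (inv g)" and "inv g \<in> G"
    using assms unfolding homeomorphism_group_def by auto
  then show "continuous_on UNIV g" "inv g \<in> G" by (auto simp: homeomorphism_def)
  from h show "bij g"
    unfolding homeomorphism_def by (metis UNIV_I bijI injI surj_def)
qed

lemma homeomorphism_group_vimage_clopen:
  assumes "homeomorphism_group G" "g \<in> G" "open S" "closed S"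
  shows "open (g -` S)" "closed (g -` S)"
  using homeomorphism_group_props(2)[OF assms(1,2)] assms(3,4)
  by (auto intro: open_vimage closed_vimage)

text \<open>Since \<open>inv g\<close> is again in \<open>G\<close>, facts about preimages, namely
  clopenness and invariance of measure, carry over to images.\<close>

lemma homeomorphism_group_image_eq_vimage:
  assumes "homeomorphism_group G" "g \<in> G"
  shows "g ` S = inv g -` S"
  using homeomorphism_group_props(1)[OF assms] by (metis bij_vimage_eq_inv_image bij_imp_bij_inv inv_inv_eq)

lemma invariant_measures_prob_space:
  assumes "M \<in> invariant_measures G"
  shows "prob_space M" "sets M = sets borel" "space M = UNIV"
proof -
  show "prob_space M" "sets M = sets borel"
    using assms by (auto simp: invariant_measures_def borel_prob_measures_def)
  then show "space M = UNIV" by (metis sets_eq_imp_space_eq space_borel)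
qed

lemma invariant_measures_vimage:
  assumes G: "homeomorphism_group G" "g \<in> G" and M: "M \<in> invariant_measures G"
    and S: "S \<in> sets borel"
  shows "measure M (g -` S) = measure M S"
proof -
  note P = invariant_measures_prob_space[OF M]
  have "g \<in> borel_measurable borel"
    using homeomorphism_group_props(2)[OF G] by (rule borel_measurable_continuous_onI)
  then have "g \<in> measurable M borel" using P(2) by (simp cong: measurable_cong_sets)
  then have "measure (distr M borel g) S = measure M (g -` S)"
    using S P(3) by (simp add: measure_distr)
  moreover have "distr M borel g = M" using M G(2) by (simp add: invariant_measures_def)
  ultimately show ?thesis by simp
qed

section \<open>Exactly divisible clopen sets and their greedy construction\<close>

text \<open>The error-free form of divisibility for a single set, with one witness common to all
  measures in \<open>K\<close>. No error accumulates under disjoint unions, as the greedy removal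
  requires.\<close>

definition clopen_divisible :: "'a::topological_space measure set \<Rightarrow> nat \<Rightarrow> 'a set \<Rightarrow> bool" where
  "clopen_divisible K n D \<longleftrightarrow> open D \<and> closed D \<and>
     (\<exists>B\<subseteq>D. open B \<and> closed B \<and> (\<forall>M\<in>K. real n * measure M B = measure M D))"

lemma clopen_divisible_Un:
  assumes K: "K \<subseteq> borel_prob_measures"
    and D: "clopen_divisible K n D" and E: "clopen_divisible K n E" and "D \<inter> E = {}"
  shows "clopen_divisible K n (D \<union> E)"
proof -
  obtain B where B: "B \<subseteq> D" "open B" "closed B" "\<forall>M\<in>K. real n * measure M B = measure M D"
    and oD: "open D" "closed D"
    using D by (auto simp: clopen_divisible_def)
  obtain C where C: "C \<subseteq> E" "open C" "closed C" "\<forall>M\<in>K. real n * measure M C = measure M E"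
    and oE: "open E" "closed E"
    using E by (auto simp: clopen_divisible_def)
  have "real n * measure M (B \<union> C) = measure M (D \<union> E)" if "M \<in> K" for M
  proof -
    interpret prob_space M using that K by (auto simp: borel_prob_measures_def)
    have s: "sets M = sets borel" using that K by (auto simp: borel_prob_measures_def)
    have "B \<inter> C = {}" using B C \<open>D \<inter> E = {}\<close> by blast
    then have "measure M (B \<union> C) = measure M B + measure M C"
      using B C by (intro finite_measure_Union) (auto simp: s)
    moreover have "measure M (D \<union> E) = measure M D + measure M E"
      using oD oE \<open>D \<inter> E = {}\<close> by (intro finite_measure_Union) (auto simp: s)
    ultimately show ?thesis using B C that by (simp add: distrib_left)
  qed
  moreover have "B \<union> C \<subseteq> D \<union> E" "open (B \<union> C)" "closed (B \<union> C)" "open (D \<union> E)" "closed (D \<union> E)"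
    using B C oD oE by auto
  ultimately show ?thesis unfolding clopen_divisible_def by blast
qed

text \<open>By invariance all \<open>n\<close> disjoint translates have the measure of
  \<open>W\<close>, so any one of them is a witness.\<close>

lemma clopen_divisible_translates:
  assumes G: "homeomorphism_group G" and W: "open W" "closed W"
    and t: "finite t" "card t = n" "n > 0" "\<And>p. p \<in> t \<Longrightarrow> h p \<in> G"
    and disj: "disjoint_family_on (\<lambda>p. h p ` W) t"
  shows "clopen_divisible (invariant_measures G) n (\<Union>p\<in>t. h p ` W)"
proof -
  have clopen: "open (h p ` W)" "closed (h p ` W)" if "p \<in> t" for p
    using homeomorphism_group_vimage_clopen[OF G homeomorphism_group_props(3)[OF G t(4)[OF that]] W]
      homeomorphism_group_image_eq_vimage[OF G t(4)[OF that]] by auto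
  have \<mu>: "measure M (h p ` W) = measure M W" if "p \<in> t" "M \<in> invariant_measures G" for p M
    using invariant_measures_vimage[OF G homeomorphism_group_props(3)[OF G t(4)[OF that(1)]] that(2)] W
      homeomorphism_group_image_eq_vimage[OF G t(4)[OF that(1)]] by auto
  obtain p where p: "p \<in> t" using t by fastforce
  have "real n * measure M (h p ` W) = measure M (\<Union>p\<in>t. h p ` W)" if M: "M \<in> invariant_measures G" for M
  proof -
    interpret prob_space M using invariant_measures_prob_space[OF M] by simp
    have "measure M (\<Union>p\<in>t. h p ` W) = (\<Sum>p\<in>t. measure M (h p ` W))"
      using clopen invariant_measures_prob_space(2)[OF M] disj
      by (intro finite_measure_finite_Union t(1)) auto
    then show ?thesis using \<mu> p M t(2) by simp
  qed
  moreover have "open (\<Union>p\<in>t. h p ` W)" "closed (\<Union>p\<in>t. h p ` W)"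
    using clopen t(1) by auto
  ultimately show ?thesis unfolding clopen_divisible_def using clopen[OF p] p by blast
qed

text \<open>An index \<open>p\<close> gives \<open>x\<close> the neighbour \<open>h p x\<close>
  whenever this point lies in \<open>U p\<close>. The groups \<open>t\<close> are treated one after
  another: for each, all complete groups of surviving neighbours are moved into \<open>D\<close> at
  once. Enlarging \<open>D\<close> later cannot undo what was achieved for earlier groups.\<close>

lemma greedy_clopen_divisible:
  fixes h :: "'p \<Rightarrow> 'a::topological_space \<Rightarrow> 'a"
  assumes G: "homeomorphism_group G" and "n > 0" and "finite T"
    and T: "\<And>t. t \<in> T \<Longrightarrow> finite t \<and> card t = n \<and> disjoint_family_on U t"
    and h: "\<And>t p. t \<in> T \<Longrightarrow> p \<in> t \<Longrightarrow> h p \<in> G"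
    and U: "\<And>t p. t \<in> T \<Longrightarrow> p \<in> t \<Longrightarrow> open (U p) \<and> closed (U p) \<and> U p \<subseteq> A"
  shows "\<exists>D\<subseteq>A. clopen_divisible (invariant_measures G) n D \<and>
           (\<forall>t\<in>T. \<nexists>x. \<forall>p\<in>t. h p x \<in> U p - D)"
  using \<open>finite T\<close> T h U
proof (induction T rule: finite_induct)
  case empty
  have "clopen_divisible (invariant_measures G) n {}"
    unfolding clopen_divisible_def by (intro conjI exI[of _ "{}"]) simp_all
  then show ?case by (intro exI[of _ "{}"]) simp
next
  case (insert t T)
  have "\<exists>D\<subseteq>A. clopen_divisible (invariant_measures G) n D \<and>
      (\<forall>t\<in>T. \<nexists>x. \<forall>p\<in>t. h p x \<in> U p - D)"
    by (rule insert.IH) (erule insert.prems[OF insertI2]; assumption)+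
  then obtain D where D: "D \<subseteq> A" "clopen_divisible (invariant_measures G) n D"
      "\<forall>t\<in>T. \<nexists>x. \<forall>p\<in>t. h p x \<in> U p - D"
    by blast
  have K: "invariant_measures G \<subseteq> borel_prob_measures"
    by (auto simp: invariant_measures_def)
  have cD: "open D" "closed D" using D by (auto simp: clopen_divisible_def)
  have t: "finite t" "card t = n" "disjoint_family_on U t" "\<And>p. p \<in> t \<Longrightarrow> h p \<in> G"
    "\<And>p. p \<in> t \<Longrightarrow> open (U p)" "\<And>p. p \<in> t \<Longrightarrow> closed (U p)" "\<And>p. p \<in> t \<Longrightarrow> U p \<subseteq> A"
    using insert.prems(1)[OF insertI1] insert.prems(2,3)[OF insertI1] by simp_all
  \<comment> \<open>\<open>W\<close> collects the points all of whose neighbours indexed by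
    \<open>t\<close> are present and still outside \<open>D\<close>; \<open>E\<close> is the set of
    these neighbours.\<close>
  define W where "W = (\<Inter>p\<in>t. h p -` (U p - D))"
  define E where "E = (\<Union>p\<in>t. h p ` W)"
  have "open (h p -` (U p - D))" "closed (h p -` (U p - D))" if "p \<in> t" for p
    using that homeomorphism_group_vimage_clopen[OF G, of "h p" "U p - D"] t cD
    by (auto simp: open_Diff closed_Diff)
  then have W: "open W" "closed W" unfolding W_def using t(1) by auto
  have sub: "h p ` W \<subseteq> U p - D" if "p \<in> t" for p using that unfolding W_def by auto
  \<comment> \<open>The translates of \<open>W\<close> inherit disjointness from the sets
    \<open>U p\<close> that contain them.\<close>
  have "disjoint_family_on (\<lambda>p. h p ` W) t"
    using t(3) sub unfolding disjoint_family_on_def by blast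
  then have "clopen_divisible (invariant_measures G) n E"
    unfolding E_def by (intro clopen_divisible_translates[OF G W t(1,2) \<open>n > 0\<close>] t(4))
  moreover have "D \<inter> E = {}" "E \<subseteq> A" using sub t(7) unfolding E_def by blast+
  ultimately have "clopen_divisible (invariant_measures G) n (D \<union> E)" "D \<union> E \<subseteq> A"
    using clopen_divisible_Un[OF K D(2)] D(1) by simp_all
  moreover have "\<nexists>x. \<forall>p\<in>t. h p x \<in> U p - (D \<union> E)"
  proof
    assume "\<exists>x. \<forall>p\<in>t. h p x \<in> U p - (D \<union> E)"
    then obtain x where x: "\<forall>p\<in>t. h p x \<in> U p - (D \<union> E)" by blast
    \<comment> \<open>A point violating the claim for \<open>t\<close> would already belong to
      \<open>W\<close>, so its neighbours would have been removed with \<open>E\<close>.\<close>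
    then have "x \<in> W" unfolding W_def by auto
    moreover obtain p where "p \<in> t" using t(1,2) \<open>n > 0\<close> by fastforce
    ultimately show False using x unfolding E_def by blast
  qed
  moreover have "\<nexists>x. \<forall>p\<in>s. h p x \<in> U p - (D \<union> E)" if "s \<in> T" for s
    using D(3) that by blast
  ultimately show ?case
    by (intro exI[of _ "D \<union> E"]) simp
qed

section \<open>Clopen partitions into pieces with many disjoint translates\<close>

text \<open>The orbit of \<open>x\<close> contains \<open>N\<close> distinct points
  \<open>f j x\<close>. Clopen sets separating them pairwise are pulled back along the maps
  \<open>f j\<close> to a neighbourhood of \<open>x\<close> on which the separation
  persists.\<close>

lemma clopen_nhd_with_disjoint_translates:
  fixes G :: "('a::topological_space \<Rightarrow> 'a) set"
  assumes X: "cantor_space (euclidean :: 'a topology)" and G: "homeomorphism_group G"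
    and dense: "closure (orbit_of G x) = UNIV"
  obtains V h where "open V" "closed V" "x \<in> V" "\<And>j. h j \<in> G"
    "disjoint_family_on (\<lambda>j. h j -` V) {..<N::nat}"
proof -
  obtain y :: "nat \<Rightarrow> 'a" where y: "inj y" "range y \<subseteq> orbit_of G x"
    using cantor_space_infinite_if_dense[OF X dense] infinite_countable_subset by blast
  have "\<exists>f. f \<in> G \<and> f x = y j" for j
  proof -
    have "y j \<in> orbit_of G x" using y(2) by blast
    then show ?thesis unfolding orbit_of_def by auto
  qed
  then obtain f where f: "\<And>j. f j \<in> G" "\<And>j. f j x = y j" by metis
  have "\<exists>C. open C \<and> closed C \<and> y j \<in> C \<and> y k \<notin> C" if "j \<noteq> k" for j k
  proof -
    have "y j \<noteq> y k" using that y(1) by (simp add: inj_eq)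
    then show ?thesis by (rule cantor_space_clopen_separation[OF X]) blast
  qed
  then obtain C where C: "\<And>j k. j \<noteq> k \<Longrightarrow>
      open (C j k) \<and> closed (C j k) \<and> y j \<in> C j k \<and> y k \<notin> C j k" by metis
  \<comment> \<open>Only finitely many pairs are separated, so that the intersection
    \<open>V\<close> remains open.\<close>
  define P where "P = {(j, k). j < N \<and> k < N \<and> j \<noteq> k}"
  have "P \<subseteq> {..<N} \<times> {..<N}" by (auto simp: P_def)
  then have finP: "finite P" by (rule finite_subset) simp
  define V where "V = (\<Inter>(j, k)\<in>P. f j -` C j k \<inter> f k -` (- C j k))"
  have "open (f j -` C j k \<inter> f k -` (- C j k))" "closed (f j -` C j k \<inter> f k -` (- C j k))"
    if "(j, k) \<in> P" for j k
  proof -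
    have "j \<noteq> k" using that by (simp add: P_def)
    then show "open (f j -` C j k \<inter> f k -` (- C j k))" "closed (f j -` C j k \<inter> f k -` (- C j k))"
      using C[of j k] homeomorphism_group_vimage_clopen[OF G f(1), of "C j k"]
        homeomorphism_group_vimage_clopen[OF G f(1), of "- C j k"]
      by (auto simp: open_Int closed_Int open_Compl closed_Compl)
  qed
  then have "open V" "closed V" unfolding V_def using finP by (auto intro!: open_INT closed_INT)
  moreover have "x \<in> V" unfolding V_def P_def using C by (auto simp: f)
  \<comment> \<open>The maps \<open>h j\<close> are the inverses of the \<open>f j\<close>: the
    preimage of \<open>V\<close> under \<open>inv (f j)\<close> is the translate of \<open>V\<close>
    by \<open>f j\<close>.\<close>
  moreover have "inv (f j) \<in> G" for j using homeomorphism_group_props(3)[OF G f(1)] .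
  moreover have "disjoint_family_on (\<lambda>j. inv (f j) -` V) {..<N}"
    unfolding disjoint_family_on_def
  proof (intro ballI impI equals0I)
    fix j k w assume jk: "j \<in> {..<N}" "k \<in> {..<N}" "j \<noteq> k"
      and "w \<in> inv (f j) -` V \<inter> inv (f k) -` V"
    moreover have "(j, k) \<in> P" using jk by (simp add: P_def)
    ultimately have "f j (inv (f j) w) \<in> C j k" "f k (inv (f k) w) \<notin> C j k"
      unfolding V_def by auto
    moreover have "f i (inv (f i) w) = w" for i
      using homeomorphism_group_props(1)[OF G f(1)] by (simp add: bij_is_surj surj_f_inv_f)
    ultimately show False by simp
  qed
  ultimately show thesis by (rule that)
qed

text \<open>Compactness leaves finitely many of the neighbourhoods \<open>V x\<close>. Shrinking
  them to disjoint pieces of \<open>A\<close> is harmless, because disjointness of translates passes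
  to subsets.\<close>

lemma clopen_partition_with_disjoint_translates:
  fixes G :: "('a::topological_space \<Rightarrow> 'a) set"
  assumes X: "cantor_space (euclidean :: 'a topology)" and G: "homeomorphism_group G"
    and dense: "\<And>x. closure (orbit_of G x) = UNIV" and A: "open A" "closed A"
  obtains m :: nat and U h where "\<And>i. open (U i)" "\<And>i. closed (U i)"
    "disjoint_family_on U {..<m}" "(\<Union>i<m. U i) = A" "\<And>i j. h i j \<in> G"
    "\<And>i. disjoint_family_on (\<lambda>j. h i j -` U i) {..<N::nat}"
proof -
  have "\<exists>V h. open V \<and> closed V \<and> x \<in> V \<and> (\<forall>j. h j \<in> G) \<and>
      disjoint_family_on (\<lambda>j. h j -` V) {..<N}" for x
    by (rule clopen_nhd_with_disjoint_translates[OF X G dense, of x N]) blast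
  then obtain V h where V: "\<And>x. open (V x)" "\<And>x. closed (V x)" "\<And>x. x \<in> V x"
      "\<And>x j. h x j \<in> G" "\<And>x. disjoint_family_on (\<lambda>j. h x j -` V x) {..<N}"
    by metis
  obtain F where F: "finite F" "UNIV \<subseteq> (\<Union>x\<in>F. V x)"
    by (rule compactE_image[OF cantor_space_compact[OF X], of UNIV V]) (use V(1,3) in auto)
  obtain m and e :: "nat \<Rightarrow> 'a" where e: "F = e ` {..<m}"
    using finite_imp_nat_seg_image_inj_on[OF F(1)] by (metis lessThan_def)
  \<comment> \<open>Each point of \<open>A\<close> is assigned to the first neighbourhood in the
    enumeration that contains it.\<close>
  define U where "U = (\<lambda>i. A \<inter> V (e i) - (\<Union>l<i. V (e l)))"
  show thesis
  proof
    show "open (U i)" "closed (U i)" for i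
      unfolding U_def using A V by (auto intro!: open_Diff closed_Diff closed_UN)
    show "disjoint_family_on U {..<m}"
      unfolding disjoint_family_on_def U_def by (auto dest!: nat_neq_iff[THEN iffD1])
    show "(\<Union>i<m. U i) = A"
    proof (intro equalityI subsetI)
      fix x assume "x \<in> A"
      have "\<exists>i. i < m \<and> x \<in> V (e i)" using F(2) e by blast
      then obtain i where i: "i < m \<and> x \<in> V (e i)" "\<And>l. l < i \<Longrightarrow> \<not> (l < m \<and> x \<in> V (e l))"
        using exists_least_iff[of "\<lambda>i. i < m \<and> x \<in> V (e i)"] by blast
      then have "x \<in> U i" using \<open>x \<in> A\<close> unfolding U_def by auto
      then show "x \<in> (\<Union>i<m. U i)" using i by blast
    qed (auto simp: U_def)
    show "h (e i) j \<in> G" for i j by (rule V)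
    show "disjoint_family_on (\<lambda>j. h (e i) j -` U i) {..<N}" for i
      using V(5)[of "e i"] unfolding disjoint_family_on_def U_def by blast
  qed
qed

section \<open>Double counting and the measure of the remainder\<close>

text \<open>The sum is the expectation of the function counting the sets \<open>S p\<close> through
  a point, and this function is bounded by \<open>n\<close>.\<close>

lemma (in prob_space) sum_prob_le_multiplicity:
  assumes "finite P" and S: "\<And>p. p \<in> P \<Longrightarrow> S p \<in> events"
    and card: "\<And>x. card {p \<in> P. x \<in> S p} \<le> n"
  shows "(\<Sum>p\<in>P. prob (S p)) \<le> real n"
proof -
  have "(\<Sum>p\<in>P. prob (S p)) = (\<Sum>p\<in>P. expectation (indicator (S p)))"
    using S by (intro sum.cong) auto
  also have "\<dots> = expectation (\<lambda>x. \<Sum>p\<in>P. indicator (S p) x)"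
    using S by (subst Bochner_Integration.integral_sum) (auto simp: emeasure_eq_measure)
  also have "\<dots> \<le> expectation (\<lambda>x. real n)"
  proof (rule integral_mono)
    show "integrable M (\<lambda>x. \<Sum>p\<in>P. indicator (S p) x :: real)"
      using S by (auto simp: emeasure_eq_measure)
    fix x
    have "(\<Sum>p\<in>P. indicator (S p) x :: real) = real (card {p \<in> P. x \<in> S p})"
      using \<open>finite P\<close> by (simp add: indicator_def sum.If_cases Int_def)
    then show "(\<Sum>p\<in>P. indicator (S p) x) \<le> real n" using card[of x] by simp
  qed simp
  finally show ?thesis by (simp add: prob_space)
qed

text \<open>The remainder \<open>A - D\<close> is bounded by counting its edges in two ways: each of
  its points has \<open>N\<close> neighbours, while no point has more than \<open>n\<close>
  neighbours in it. As \<open>N\<close> is arbitrary, the remainder can be made small uniformly in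
  \<open>M\<close>.\<close>

lemma invariant_measures_approx_clopen_divisible:
  fixes G :: "('a::topological_space \<Rightarrow> 'a) set"
  assumes X: "cantor_space (euclidean :: 'a topology)" and G: "homeomorphism_group G"
    and dense: "\<And>x. closure (orbit_of G x) = UNIV" and A: "open A" "closed A" and "n > 0"
  obtains D where "D \<subseteq> A" "clopen_divisible (invariant_measures G) n D"
    "\<And>M. M \<in> invariant_measures G \<Longrightarrow> real N * measure M (A - D) \<le> real n"
proof -
  obtain m :: nat and U h where U: "\<And>i. open (U i)" "\<And>i. closed (U i)"
    "disjoint_family_on U {..<m}" "(\<Union>i<m. U i) = A" and hG: "\<And>i j. h i j \<in> G"
    and h: "\<And>i. disjoint_family_on (\<lambda>j. h i j -` U i) {..<N}"
    using clopen_partition_with_disjoint_translates[OF X G dense A] by metis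
  \<comment> \<open>A pair \<open>(i, j)\<close> stands for the \<open>j\<close>-th translate of the
    piece \<open>U i\<close>.\<close>
  define P where "P = {..<m} \<times> {..<N}"
  have finP: "finite P" by (simp add: P_def)
  \<comment> \<open>These are the groups of \<open>n\<close> indices whose pieces are pairwise
    disjoint, as the greedy construction demands.\<close>
  define T where "T = {t. t \<subseteq> P \<and> card t = n \<and> disjoint_family_on (\<lambda>p. U (fst p)) t}"
  have "finite T" by (rule finite_subset[of _ "Pow P"]) (auto simp: T_def finP)
  have "\<exists>D\<subseteq>A. clopen_divisible (invariant_measures G) n D \<and>
           (\<forall>t\<in>T. \<nexists>x. \<forall>p\<in>t. case_prod h p x \<in> U (fst p) - D)"
  proof (rule greedy_clopen_divisible[OF G \<open>n > 0\<close> \<open>finite T\<close>])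
    show "finite t \<and> card t = n \<and> disjoint_family_on (\<lambda>p. U (fst p)) t" if "t \<in> T" for t
      using that finP by (auto simp: T_def intro: finite_subset)
    show "case_prod h p \<in> G" for p using hG by (cases p) simp
    show "open (U (fst p)) \<and> closed (U (fst p)) \<and> U (fst p) \<subseteq> A" if "t \<in> T" "p \<in> t" for t p
    proof -
      have "fst p < m" using that by (auto simp: T_def P_def)
      then show ?thesis using U by blast
    qed
  qed
  then obtain D where D: "D \<subseteq> A" "clopen_divisible (invariant_measures G) n D"
      "\<And>t x. t \<in> T \<Longrightarrow> \<not> (\<forall>p\<in>t. case_prod h p x \<in> U (fst p) - D)" by blast
  have cD: "open D" "closed D" using D by (auto simp: clopen_divisible_def)
  \<comment> \<open>\<open>S p\<close> is the set of points whose neighbour with index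
    \<open>p\<close> survives in \<open>A - D\<close>, for \<open>p\<close> in
    \<open>P\<close>.\<close>
  define S where "S = (\<lambda>p. case_prod h p -` (U (fst p) - D))"
  have S: "S p \<in> sets borel" for p
    using homeomorphism_group_vimage_clopen[OF G hG, of "U (fst p) - D" "fst p" "snd p"] U cD
    by (auto simp: S_def open_Diff closed_Diff case_prod_beta)
  \<comment> \<open>If more than \<open>n\<close> indices survived at \<open>x\<close>, then
    \<open>n\<close> of them would form a group in \<open>T\<close> that is still complete at
    \<open>x\<close>, contrary to the choice of \<open>D\<close>.\<close>
  have card: "card {p \<in> P. x \<in> S p} \<le> n" for x
  proof (rule ccontr)
    assume "\<not> ?thesis"
    then obtain t where t: "t \<subseteq> {p \<in> P. x \<in> S p}" "card t = n"
      by (meson obtain_subset_with_card_n nat_le_linear)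
    have "disjoint_family_on (\<lambda>p. U (fst p)) t"
      unfolding disjoint_family_on_def
    proof (intro ballI impI)
      fix p q assume pq: "p \<in> t" "q \<in> t" "p \<noteq> q"
      obtain i j k l where ijkl: "p = (i, j)" "q = (k, l)" by (metis surj_pair)
      have mem: "i < m" "k < m" "j < N" "l < N" "x \<in> h i j -` U i" "x \<in> h k l -` U k"
        using pq t(1) ijkl by (auto simp: P_def S_def)
      \<comment> \<open>The translates of one piece are disjoint, so two different indices surviving
        at the same \<open>x\<close> belong to different pieces.\<close>
      have "i \<noteq> k"
      proof
        assume "i = k"
        then have "j \<noteq> l" using pq ijkl by simp
        then show False using mem h[of i] \<open>i = k\<close> unfolding disjoint_family_on_def by blast
      qed
      then show "U (fst p) \<inter> U (fst q) = {}"
        using U(3) mem ijkl unfolding disjoint_family_on_def by auto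
    qed
    then have "t \<in> T" using t by (auto simp: T_def)
    moreover have "\<forall>p\<in>t. case_prod h p x \<in> U (fst p) - D" using t(1) by (auto simp: S_def)
    ultimately show False using D(3) by blast
  qed
  show thesis
  proof
    fix M assume M: "M \<in> invariant_measures G"
    interpret prob_space M using invariant_measures_prob_space[OF M] by simp
    have sM: "sets M = sets borel" using invariant_measures_prob_space[OF M] by simp
    have UD: "U i - D \<in> sets borel" for i using U cD by auto
    have "real N * prob (A - D) = real N * (\<Sum>i<m. prob (U i - D))"
    proof -
      have "A - D = (\<Union>i<m. U i - D)" using U(4) by blast
      moreover have "disjoint_family_on (\<lambda>i. U i - D) {..<m}"
        using U(3) unfolding disjoint_family_on_def by blast
      ultimately have "prob (A - D) = (\<Sum>i<m. prob (U i - D))"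
        using UD sM finite_measure_finite_Union[of "{..<m}" "\<lambda>i. U i - D"]
        by (simp add: image_subset_iff del: UN_simps)
      then show ?thesis by simp
    qed
    \<comment> \<open>The factor \<open>N\<close> becomes one copy of \<open>U i - D\<close> for
      each translate; invariance then replaces the copies by the sets
      \<open>S (i, j)\<close>.\<close>
    also have "\<dots> = (\<Sum>i<m. \<Sum>j<N. prob (U i - D))" by (simp add: sum_distrib_left)
    also have "\<dots> = (\<Sum>i<m. \<Sum>j<N. prob (S (i, j)))"
      using invariant_measures_vimage[OF G hG M UD] by (simp add: S_def)
    also have "\<dots> = (\<Sum>p\<in>P. prob (S p))"
      unfolding P_def by (simp add: sum.cartesian_product)
    also have "\<dots> \<le> real n"
      using S card sM finP by (intro sum_prob_le_multiplicity) auto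
    finally show "real N * prob (A - D) \<le> real n" .
  qed (use D in auto)
qed

theorem theorem2p1:
  fixes G :: "('a::topological_space \<Rightarrow> 'a) set"
  assumes "cantor_space (euclidean :: 'a topology)"
    and "homeomorphism_group G"
    and "\<And>x. closure (orbit_of G x) = UNIV"
  shows "approximately_divisible (invariant_measures G)"
  unfolding approximately_divisible_def
proof (intro conjI allI impI)
  show "invariant_measures G \<subseteq> borel_prob_measures"
    by (auto simp: invariant_measures_def)
next
  fix A :: "'a set" and n :: nat and \<epsilon> :: real
  assume A: "open A \<and> closed A" and n: "n > 0" and \<epsilon>: "\<epsilon> > 0"
  \<comment> \<open>\<open>N\<close> depends only on \<open>n\<close> and \<open>\<epsilon>\<close>,
    so \<open>D\<close> and \<open>B\<close> are fixed before any measure is considered and serve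
    all of them.\<close>
  obtain N :: nat where N: "real n / \<epsilon> < real N" using reals_Archimedean2 by blast
  obtain D where D: "D \<subseteq> A" "clopen_divisible (invariant_measures G) n D"
    "\<And>M. M \<in> invariant_measures G \<Longrightarrow> real N * measure M (A - D) \<le> real n"
    using invariant_measures_approx_clopen_divisible[OF assms _ _ n] A by metis
  obtain B where B: "B \<subseteq> D" "open B" "closed B" and cD: "open D" "closed D"
    and nB: "\<And>M. M \<in> invariant_measures G \<Longrightarrow> real n * measure M B = measure M D"
    using D(2) by (auto simp: clopen_divisible_def)
  have "measure M A - \<epsilon> \<le> real n * measure M B \<and> real n * measure M B \<le> measure M A"
    if M: "M \<in> invariant_measures G" for M
  proof -
    interpret prob_space M using invariant_measures_prob_space[OF M] by simp
    have diff: "prob (A - D) = prob A - prob D"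
      using A cD D(1) invariant_measures_prob_space(2)[OF M] by (intro finite_measure_Diff) auto
    have "real n < real N * \<epsilon>" using N \<epsilon> by (simp add: divide_less_eq)
    then have "real N * prob (A - D) < real N * \<epsilon>" using D(3)[OF M] by linarith
    then have "prob (A - D) \<le> \<epsilon>" by (simp add: mult_less_cancel_left)
    \<comment> \<open>Since \<open>n\<close> times the measure of \<open>B\<close> equals
      \<open>prob A - prob (A - D)\<close>, this gives the upper estimate and the preceding bound
      gives the lower one.\<close>
    moreover have "0 \<le> prob (A - D)" by simp
    ultimately show ?thesis using diff nB[OF M] by simp
  qed
  then show "\<exists>B. open B \<and> closed B \<and> B \<subseteq> A \<and> (\<forall>M\<in>invariant_measures G.
      measure M A - \<epsilon> \<le> real n * measure M B \<and> real n * measure M B \<le> measure M A)"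
    using B D(1) by (intro exI[of _ B]) auto
qed

end
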